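(* Let $\mathbf{k}$ be a commutative ring, $q\in\mathbf{k}$ and $r:=q+1$. Let $R_q:\mathrm{QSym}\to\mathrm{QSym}$ be the $\mathbf{k}$-linear map that sends each $M_\alpha$ (with $\alpha\in\mathrm{Comp}$) to $r^{\ell(\overline{\alpha})}M_{\overline{\alpha}}$, where $\overline{\alpha}$ denotes the complement of $\alpha$. Let $\alpha\in\mathrm{Comp}$. Then $$\eta_\alpha^{(q)}=R_q\left(L_{\overline{\alpha}}\right).$$
   Context: For an integer $m$, $[m]=\{1,2,\ldots,m\}$ (empty if $m\le 0$). A composition is a finite tuple $\alpha=(\alpha_1,\ldots,\alpha_k)$ of positive integers; its length is $\ell(\alpha)=k$, its size is $|\alpha|=\alpha_1+\cdots+\alpha_k$. $\mathrm{Comp}$ is the set of all compositions (including the empty one), and $\mathrm{Comp}_n$ the set of compositions of size $n$. For $\alpha=(\alpha_1,\ldots,\alpha_k)\in\mathrm{Comp}_n$ set $D(\alpha)=\{\alpha_1+\cdots+\alpha_i \mid i\in[k-1]\}\subseteq[n-1]$; the map $D$ is a bijection from $\mathrm{Comp}_n$ to the set of subsets of $[n-1]$. The complement $\overline{\alpha}$ of $\alpha\in\mathrm{Comp}_n$ is the unique $\gamma\in\mathrm{Comp}_n$ with $D(\gamma)=[n-1]\setminus D(\alpha)$. $\mathrm{QSym}\subseteq\mathbf{k}[[x_1,x_2,\ldots]]$ is the algebra of quasisymmetric functions over $\mathbf{k}$, with $\mathbf{k}$-basis $(M_\alpha)_{\alpha\in\mathrm{Comp}}$ where $M_\alpha=\sum_{i_1<i_2<\cdots<i_\ell}x_{i_1}^{\alpha_1}\cdots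 x_{i_\ell}^{\alpha_\ell}$ for $\alpha=(\alpha_1,\ldots,\alpha_\ell)$. For $\alpha\in\mathrm{Comp}_n$, $L_\alpha=\sum_{\beta\in\mathrm{Comp}_n;\ D(\beta)\supseteq D(\alpha)}M_\beta$, and $\eta_\alpha^{(q)}=\sum_{\beta\in\mathrm{Comp}_n;\ D(\beta)\subseteq D(\alpha)}r^{\ell(\beta)}M_\beta$. *)

theory Defs
  imports Complex_Main "HOL-Library.Poly_Mapping"
begin

text \<open>
  The base ring \<open>\<k>\<close> is a type of sort \<open>{comm_ring, monoid_mult}\<close>: a commutative ring with unity in
  which \<open>0 = 1\<close> is allowed.  (The class \<open>comm_ring_1\<close> would exclude the zero ring.)
\<close>

section \<open>Compositions\<close>

definition Comp :: "nat list set" where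
  "Comp = {\<alpha>. \<forall>a\<in>set \<alpha>. 0 < a}"

definition Comp_n :: "nat \<Rightarrow> nat list set" where
  "Comp_n n = {\<alpha> \<in> Comp. sum_list \<alpha> = n}"

text \<open>
  Truncated subtraction is harmless here and below: for \<open>\<alpha> = []\<close> the index range \<open>{1..0 - 1}\<close> is empty.
\<close>

definition D :: "nat list \<Rightarrow> nat set" where
  "D \<alpha> = {sum_list (take i \<alpha>) | i. i \<in> {1..length \<alpha> - 1}}"

definition compl :: "nat list \<Rightarrow> nat list" where
  "compl \<alpha> = (THE \<gamma>. \<gamma> \<in> Comp_n (sum_list \<alpha>) \<and> D \<gamma> = {1..sum_list \<alpha> - 1} - D \<alpha>)"

section \<open>Formal power series in countably many variables\<close>

text \<open>
  A monomial is its finitely supported exponent vector, and a power series is its family of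
  coefficients.  The variables are indexed from \<open>0\<close>: index \<open>i\<close> stands for the variable \<open>x\<^sub>i\<^sub>+\<^sub>1\<close>.
  Only the \<open>\<k>\<close>-module structure is provided.  (A type of its own is used because the pointwise
  product of functions is not the product of power series.)
\<close>

typedef 'k mpseries = "UNIV :: ((nat \<Rightarrow>\<^sub>0 nat) \<Rightarrow> 'k) set"
  morphisms coeff mpseries_of ..

setup_lifting type_definition_mpseries

lemma mpseries_eqI: "(\<And>m. coeff f m = coeff g m) \<Longrightarrow> f = g"
  by (metis coeff_inverse ext)

instantiation mpseries :: (ab_group_add) ab_group_add
begin
lift_definition zero_mpseries :: "'a mpseries" is "\<lambda>_. 0" .
lift_definition plus_mpseries :: "'a mpseries \<Rightarrow> 'a mpseries \<Rightarrow> 'a mpseries" is "\<lambda>f g m. f m + g m" .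
lift_definition minus_mpseries :: "'a mpseries \<Rightarrow> 'a mpseries \<Rightarrow> 'a mpseries" is "\<lambda>f g m. f m - g m" .
lift_definition uminus_mpseries :: "'a mpseries \<Rightarrow> 'a mpseries" is "\<lambda>f m. - f m" .
instance
  by standard (transfer; simp add: fun_eq_iff algebra_simps)+
end

lift_definition scale :: "'k::times \<Rightarrow> 'k mpseries \<Rightarrow> 'k mpseries" (infixr "*\<^sub>k" 75)
  is "\<lambda>c f m. c * f m" .

lemma coeff_zero [simp]: "coeff 0 m = 0" by transfer simp
lemma coeff_plus [simp]: "coeff (f + g) m = coeff f m + coeff g m" by transfer simp
lemma coeff_scale [simp]: "coeff (c *\<^sub>k f) m = c * coeff f m" by transfer simp
lemma coeff_sum [simp]: "coeff (sum f A) m = (\<Sum>x\<in>A. coeff (f x) m)"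
  by (induction A rule: infinite_finite_induct) auto

definition mono_of :: "nat list \<Rightarrow> nat list \<Rightarrow> (nat \<Rightarrow>\<^sub>0 nat)" where
  "mono_of is \<alpha> = (\<Sum>j<length \<alpha>. Poly_Mapping.single (is ! j) (\<alpha> ! j))"

definition deg :: "(nat \<Rightarrow>\<^sub>0 nat) \<Rightarrow> nat" where
  "deg m = (\<Sum>i\<in>Poly_Mapping.keys m. Poly_Mapping.lookup m i)"

definition incr_seqs :: "nat \<Rightarrow> nat list set" where
  "incr_seqs l = {is. sorted_wrt (<) is \<and> length is = l}"

section \<open>Quasisymmetric functions\<close>

definition QSym :: "'k::{comm_ring,monoid_mult} mpseries set" where
  "QSym = {f. (\<exists>d. \<forall>m. coeff f m \<noteq> 0 \<longrightarrow> deg m \<le> d) \<and>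
              (\<forall>\<alpha>\<in>Comp. \<forall>is\<in>incr_seqs (length \<alpha>). \<forall>js\<in>incr_seqs (length \<alpha>).
                 coeff f (mono_of is \<alpha>) = coeff f (mono_of js \<alpha>))}"

text \<open>
  The infinite sum defining \<open>M\<^sub>\<alpha>\<close>, taken coefficientwise: the coefficient of a monomial \<open>m\<close> is the sum of
  \<open>1\<close> over all index sequences that produce \<open>m\<close>.  For \<open>\<alpha> \<in> Comp\<close> there is at most one such sequence,
  by \<open>mono_of_inj\<close> below.
\<close>

definition M :: "nat list \<Rightarrow> 'k::{comm_ring,monoid_mult} mpseries" where
  "M \<alpha> = mpseries_of (\<lambda>m. \<Sum>is\<in>{is \<in> incr_seqs (length \<alpha>). mono_of is \<alpha> = m}. 1)"

definition L :: "nat list \<Rightarrow> 'k::{comm_ring,monoid_mult} mpseries" where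
  "L \<alpha> = (\<Sum>\<beta>\<in>{\<beta> \<in> Comp_n (sum_list \<alpha>). D \<beta> \<supseteq> D \<alpha>}. M \<beta>)"

definition eta :: "'k::{comm_ring,monoid_mult} \<Rightarrow> nat list \<Rightarrow> 'k mpseries" where
  "eta q \<alpha> = (let r = q + 1 in
     (\<Sum>\<beta>\<in>{\<beta> \<in> Comp_n (sum_list \<alpha>). D \<beta> \<subseteq> D \<alpha>}. r ^ length \<beta> *\<^sub>k M \<beta>))"

text \<open>Linear endomorphisms of \<open>QSym\<close>; values outside \<open>QSym\<close> are unconstrained.\<close>

definition linear_QSym ::
  "('k::{comm_ring,monoid_mult} mpseries \<Rightarrow> 'k mpseries) \<Rightarrow> bool" where
  "linear_QSym R \<longleftrightarrow>
     (\<forall>f\<in>QSym. R f \<in> QSym) \<and>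
     (\<forall>f\<in>QSym. \<forall>g\<in>QSym. R (f + g) = R f + R g) \<and>
     (\<forall>c. \<forall>f\<in>QSym. R (c *\<^sub>k f) = c *\<^sub>k R f)"

definition is_R ::
  "'k::{comm_ring,monoid_mult} \<Rightarrow> ('k mpseries \<Rightarrow> 'k mpseries) \<Rightarrow> bool" where
  "is_R q R \<longleftrightarrow> linear_QSym R \<and>
     (\<forall>\<alpha>\<in>Comp. R (M \<alpha>) = (let r = q + 1 in r ^ length (compl \<alpha>) *\<^sub>k M (compl \<alpha>)))"

section \<open>The definitions above are well posed\<close>

lemma finite_Comp_le: "finite {\<alpha> \<in> Comp. sum_list \<alpha> \<le> n}"
proof (rule finite_subset)
  have "length \<alpha> \<le> sum_list \<alpha>" if "\<alpha> \<in> Comp" for \<alpha>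
    using that by (induction \<alpha>) (auto simp: Comp_def Suc_le_eq)
  then show "{\<alpha> \<in> Comp. sum_list \<alpha> \<le> n} \<subseteq> {\<alpha>. set \<alpha> \<subseteq> {..n} \<and> length \<alpha> \<le> n}"
    by (auto intro: member_le_sum_list order_trans)
qed (simp add: finite_lists_length_le)

lemma finite_Comp_n: "finite (Comp_n n)"
  by (rule finite_subset[OF _ finite_Comp_le[of n]]) (auto simp: Comp_n_def)

lemma D_image: "D \<alpha> = (\<lambda>i. sum_list (take i \<alpha>)) ` {1..length \<alpha> - 1}"
  by (auto simp: D_def)

lemma D_snoc:
  assumes "\<gamma> \<noteq> []" shows "D (\<gamma> @ [a]) = insert (sum_list \<gamma>) (D \<gamma>)"
proof -
  have "{1..length \<gamma>} = insert (length \<gamma>) {1..length \<gamma> - 1}"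
    using assms by (cases \<gamma>) auto
  then show ?thesis
    unfolding D_image by (auto simp: image_insert intro!: arg_cong2[where f = insert] image_cong)
qed

lemma D_single [simp]: "D [a] = {}" "D [] = {}"
  by (auto simp: D_def)

lemma sum_list_pos_Comp: "\<alpha> \<in> Comp \<Longrightarrow> \<alpha> \<noteq> [] \<Longrightarrow> 0 < sum_list \<alpha>"
  by (cases \<alpha>) (auto simp: Comp_def)

lemma D_subset: "\<alpha> \<in> Comp \<Longrightarrow> D \<alpha> \<subseteq> {1..sum_list \<alpha> - 1}"
proof (induction \<alpha> rule: rev_induct)
  case (snoc a \<alpha>)
  then have "\<alpha> \<in> Comp" "0 < a" by (auto simp: Comp_def)
  show ?case
  proof (cases "\<alpha> = []")
    case False
    then have "0 < sum_list \<alpha>" using \<open>\<alpha> \<in> Comp\<close> by (intro sum_list_pos_Comp)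
    moreover have "D \<alpha> \<subseteq> {1..sum_list \<alpha> - 1}" using snoc.IH \<open>\<alpha> \<in> Comp\<close> .
    ultimately show ?thesis using False \<open>0 < a\<close> by (fastforce simp: D_snoc)
  qed simp
qed simp

lemma D_inj:
  assumes "\<alpha> \<in> Comp" "\<beta> \<in> Comp" "sum_list \<alpha> = sum_list \<beta>" "D \<alpha> = D \<beta>"
  shows "\<alpha> = \<beta>"
  using assms
proof (induction \<alpha> arbitrary: \<beta> rule: rev_induct)
  case Nil
  have "sum_list \<beta> = 0" using Nil.prems(3) by simp
  then show ?case using sum_list_pos_Comp[OF Nil.prems(2)] by (metis less_irrefl)
next
  have last_max: "Max (insert (sum_list \<gamma>) (D \<gamma>)) = sum_list \<gamma>" "sum_list \<gamma> \<notin> D \<gamma>"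
    if "\<gamma> \<in> Comp" "\<gamma> \<noteq> []" for \<gamma>
  proof -
    have "0 < sum_list \<gamma>" using that by (rule sum_list_pos_Comp)
    moreover have "D \<gamma> \<subseteq> {1..sum_list \<gamma> - 1}" using that by (intro D_subset)
    ultimately have lt: "x < sum_list \<gamma>" if "x \<in> D \<gamma>" for x using that by fastforce
    then show "sum_list \<gamma> \<notin> D \<gamma>" by blast
    have "finite (D \<gamma>)" unfolding D_def by simp
    then show "Max (insert (sum_list \<gamma>) (D \<gamma>)) = sum_list \<gamma>"
      using lt by (intro Max_eqI) (auto intro: less_imp_le)
  qed
  case (snoc a \<alpha>)
  have a: "\<alpha> \<in> Comp" "0 < a" using snoc.prems by (auto simp: Comp_def)
  have "\<beta> \<noteq> []" using snoc.prems a by auto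
  then obtain \<beta>' b where b: "\<beta> = \<beta>' @ [b]" by (metis rev_exhaust)
  have b': "\<beta>' \<in> Comp" "0 < b" using snoc.prems b by (auto simp: Comp_def)
  consider "\<alpha> = []" "\<beta>' = []" | "\<alpha> \<noteq> []" "\<beta>' \<noteq> []"
    using snoc.prems b by (cases "\<alpha> = []"; cases "\<beta>' = []") (auto simp: D_snoc)
  then show ?case
  proof cases
    case 1 then show ?thesis using snoc.prems b by simp
  next
    case 2
    then have eq: "insert (sum_list \<alpha>) (D \<alpha>) = insert (sum_list \<beta>') (D \<beta>')"
      using snoc.prems b by (simp add: D_snoc)
    then have s: "sum_list \<alpha> = sum_list \<beta>'" using last_max a b' 2 by metis
    then have "D \<alpha> = D \<beta>'" using eq last_max a b' 2 by (metis insert_ident)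
    then have "\<alpha> = \<beta>'" using snoc.IH a b' s by blast
    then show ?thesis using snoc.prems b by simp
  qed
qed

lemma D_surj: "S \<subseteq> {1..n - 1} \<Longrightarrow> \<exists>\<gamma>\<in>Comp_n n. D \<gamma> = S"
proof (induction n arbitrary: S rule: less_induct)
  case (less n)
  show ?case
  proof (cases "S = {}")
    case True
    have "(if n = 0 then [] else [n]) \<in> Comp_n n" by (auto simp: Comp_n_def Comp_def)
    then show ?thesis using True by (intro bexI[of _ "if n = 0 then [] else [n]"]) auto
  next
    case False
    have fin: "finite S" using less.prems by (rule finite_subset) simp
    define a where "a = Max S"
    have a: "a \<in> S" "\<And>x. x \<in> S \<Longrightarrow> x \<le> a" using fin False by (auto simp: a_def)
    then have an: "0 < a" "a < n" using less.prems by fastforce+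
    have "S - {a} \<subseteq> {1..a - 1}"
    proof
      fix x assume "x \<in> S - {a}"
      then have "x < a" "x \<in> {1..n - 1}" using a(2)[of x] less.prems by auto
      then show "x \<in> {1..a - 1}" by auto
    qed
    from less.IH[OF an(2) this] obtain \<gamma> where g: "\<gamma> \<in> Comp_n a" "D \<gamma> = S - {a}" by blast
    then have sum: "sum_list \<gamma> = a" by (simp add: Comp_n_def)
    then have "\<gamma> \<noteq> []" using an by (metis less_irrefl sum_list.Nil)
    then have "D (\<gamma> @ [n - a]) = insert a (S - {a})" using g(2) sum by (metis D_snoc)
    also have "\<dots> = S" using a(1) by blast
    finally have "D (\<gamma> @ [n - a]) = S" .
    moreover have "\<gamma> @ [n - a] \<in> Comp_n n" using g an by (auto simp: Comp_n_def Comp_def)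
    ultimately show ?thesis by blast
  qed
qed

lemma D_bij: "bij_betw D (Comp_n n) (Pow {1..n - 1})"
proof (rule bij_betw_imageI)
  show "inj_on D (Comp_n n)" by (rule inj_onI) (auto simp: Comp_n_def intro: D_inj)
  show "D ` Comp_n n = Pow {1..n - 1}"
  proof (intro equalityI subsetI)
    fix S assume "S \<in> D ` Comp_n n"
    then show "S \<in> Pow {1..n - 1}" using D_subset by (fastforce simp: Comp_n_def)
  next
    fix S assume "S \<in> Pow {1..n - 1}"
    then show "S \<in> D ` Comp_n n" using D_surj[of S n] by (metis PowD imageI)
  qed
qed

lemma compl_props:
  "compl \<alpha> \<in> Comp_n (sum_list \<alpha>)" "D (compl \<alpha>) = {1..sum_list \<alpha> - 1} - D \<alpha>"
proof -
  have "\<exists>!\<gamma>. \<gamma> \<in> Comp_n (sum_list \<alpha>) \<and> D \<gamma> = {1..sum_list \<alpha> - 1} - D \<alpha>"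
    using D_surj[of "{1..sum_list \<alpha> - 1} - D \<alpha>" "sum_list \<alpha>"] D_inj
    by (auto simp: Comp_n_def)
  from theI'[OF this] show
    "compl \<alpha> \<in> Comp_n (sum_list \<alpha>)" "D (compl \<alpha>) = {1..sum_list \<alpha> - 1} - D \<alpha>"
    by (simp_all add: compl_def)
qed

lemma lookup_mono_of:
  assumes "is \<in> incr_seqs (length \<alpha>)" "j < length \<alpha>"
  shows "Poly_Mapping.lookup (mono_of is \<alpha>) (is ! j) = \<alpha> ! j"
proof -
  have "distinct is" "length is = length \<alpha>"
    using assms by (auto simp: incr_seqs_def strict_sorted_iff)
  then have "(\<Sum>i<length \<alpha>. (\<alpha> ! i when is ! i = is ! j)) = (\<Sum>i<length \<alpha>. (\<alpha> ! i when i = j))"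
    using assms by (intro sum.cong) (auto simp: nth_eq_iff_index_eq)
  also have "\<dots> = \<alpha> ! j" using assms by (simp add: when_def)
  finally show ?thesis by (simp add: mono_of_def lookup_sum lookup_single)
qed

lemma keys_mono_of:
  assumes "is \<in> incr_seqs (length \<alpha>)" "\<alpha> \<in> Comp"
  shows "Poly_Mapping.keys (mono_of is \<alpha>) = set is"
proof -
  have len: "length is = length \<alpha>" using assms by (simp add: incr_seqs_def)
  have "Poly_Mapping.lookup (mono_of is \<alpha>) v = 0" if "v \<notin> set is" for v
    using that len by (auto simp: mono_of_def lookup_sum lookup_single when_def intro!: sum.neutral)
  moreover have "Poly_Mapping.lookup (mono_of is \<alpha>) v \<noteq> 0" if "v \<in> set is" for v
    using that len lookup_mono_of[OF assms(1)] assms(2)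
    by (auto simp: in_set_conv_nth Comp_def)
  ultimately show ?thesis by (auto simp: in_keys_iff)
qed

lemma mono_of_inj:
  assumes "is \<in> incr_seqs (length \<alpha>)" "\<alpha> \<in> Comp" "js \<in> incr_seqs (length \<beta>)" "\<beta> \<in> Comp"
    and eq: "mono_of is \<alpha> = mono_of js \<beta>"
  shows "is = js \<and> \<alpha> = \<beta>"
proof -
  have "set is = set js" using keys_mono_of assms by metis
  then have ij: "is = js"
    using assms by (auto simp: incr_seqs_def intro: strict_sorted_equal)
  then have "length \<alpha> = length \<beta>" using assms by (simp add: incr_seqs_def)
  then show ?thesis using ij lookup_mono_of assms by (metis nth_equalityI)
qed

lemma mono_of_exists: "\<exists>\<alpha>\<in>Comp. \<exists>is\<in>incr_seqs (length \<alpha>). mono_of is \<alpha> = m"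
proof -
  define "is" where "is = sorted_list_of_set (Poly_Mapping.keys m)"
  define \<alpha> where "\<alpha> = map (Poly_Mapping.lookup m) is"
  have i: "is \<in> incr_seqs (length \<alpha>)" and set: "set is = Poly_Mapping.keys m"
    by (auto simp: incr_seqs_def \<alpha>_def is_def)
  have a: "\<alpha> \<in> Comp" using set by (auto simp: Comp_def \<alpha>_def in_keys_iff)
  have "mono_of is \<alpha> = m"
  proof (rule poly_mapping_eqI)
    fix v show "Poly_Mapping.lookup (mono_of is \<alpha>) v = Poly_Mapping.lookup m v"
    proof (cases "v \<in> set is")
      case True
      then show ?thesis using lookup_mono_of[OF i] by (auto simp: in_set_conv_nth \<alpha>_def)
    next
      case False
      then show ?thesis using keys_mono_of[OF i a] set by (metis in_keys_iff)
    qed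
  qed
  then show ?thesis using a i by blast
qed

lemma deg_mono_of:
  assumes "is \<in> incr_seqs (length \<alpha>)" "\<alpha> \<in> Comp"
  shows "deg (mono_of is \<alpha>) = sum_list \<alpha>"
proof -
  have d: "distinct is" "length is = length \<alpha>"
    using assms by (auto simp: incr_seqs_def strict_sorted_iff)
  have "deg (mono_of is \<alpha>) = sum_list (map (Poly_Mapping.lookup (mono_of is \<alpha>)) is)"
    using d by (simp add: deg_def keys_mono_of[OF assms] sum_list_distinct_conv_sum_set)
  also have "map (Poly_Mapping.lookup (mono_of is \<alpha>)) is = \<alpha>"
    using d lookup_mono_of[OF assms(1)] by (intro nth_equalityI) auto
  finally show ?thesis .
qed

lemma coeff_M:
  assumes "\<alpha> \<in> Comp" "\<beta> \<in> Comp" "is \<in> incr_seqs (length \<beta>)"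
  shows "coeff (M \<alpha> :: 'k::{comm_ring,monoid_mult} mpseries) (mono_of is \<beta>) = (if \<alpha> = \<beta> then 1 else 0)"
proof -
  have "{js \<in> incr_seqs (length \<alpha>). mono_of js \<alpha> = mono_of is \<beta>} = (if \<alpha> = \<beta> then {is} else {})"
    using assms mono_of_inj by auto
  then show ?thesis by (simp add: M_def mpseries_of_inverse)
qed

lemma M_in_QSym: "\<alpha> \<in> Comp \<Longrightarrow> M \<alpha> \<in> QSym"
proof -
  assume a: "\<alpha> \<in> Comp"
  have "deg m \<le> sum_list \<alpha>" if nz: "coeff (M \<alpha> :: 'a mpseries) m \<noteq> 0" for m
  proof -
    obtain \<beta> "is" where b: "\<beta> \<in> Comp" "is \<in> incr_seqs (length \<beta>)" "m = mono_of is \<beta>"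
      using mono_of_exists by metis
    then show ?thesis using nz a by (simp add: coeff_M deg_mono_of split: if_splits)
  qed
  then show ?thesis using a by (auto simp: QSym_def coeff_M)
qed

lemma zero_in_QSym: "0 \<in> QSym"
  by (auto simp: QSym_def)

lemma QSym_coeff_eq:
  "f \<in> QSym \<Longrightarrow> \<alpha> \<in> Comp \<Longrightarrow> is \<in> incr_seqs (length \<alpha>) \<Longrightarrow> js \<in> incr_seqs (length \<alpha>) \<Longrightarrow>
    coeff f (mono_of is \<alpha>) = coeff f (mono_of js \<alpha>)"
  unfolding QSym_def by blast

lemma QSym_degE:
  assumes "f \<in> QSym"
  obtains d where "\<And>m. coeff f m \<noteq> 0 \<Longrightarrow> deg m \<le> d"
  using assms unfolding QSym_def by blast

lemma QSymI:
  assumes "\<And>m. coeff f m \<noteq> 0 \<Longrightarrow> deg m \<le> d"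
    and "\<And>\<alpha> is js. \<alpha> \<in> Comp \<Longrightarrow> is \<in> incr_seqs (length \<alpha>) \<Longrightarrow> js \<in> incr_seqs (length \<alpha>) \<Longrightarrow>
      coeff f (mono_of is \<alpha>) = coeff f (mono_of js \<alpha>)"
  shows "f \<in> QSym"
  using assms unfolding QSym_def by blast

lemma scale_in_QSym:
  assumes "f \<in> QSym" shows "c *\<^sub>k f \<in> QSym"
proof -
  obtain d where d: "\<And>m. coeff f m \<noteq> 0 \<Longrightarrow> deg m \<le> d" using assms by (rule QSym_degE) blast
  show ?thesis
  proof (rule QSymI)
    show "deg m \<le> d" if "coeff (c *\<^sub>k f) m \<noteq> 0" for m
      using that by (intro d) auto
  qed (metis QSym_coeff_eq[OF assms] coeff_scale)
qed

lemma plus_in_QSym: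
  assumes "f \<in> QSym" "g \<in> QSym" shows "f + g \<in> QSym"
proof -
  obtain d where d: "\<And>m. coeff f m \<noteq> 0 \<Longrightarrow> deg m \<le> d" using assms(1) by (rule QSym_degE) blast
  obtain e where e: "\<And>m. coeff g m \<noteq> 0 \<Longrightarrow> deg m \<le> e" using assms(2) by (rule QSym_degE) blast
  show ?thesis
  proof (rule QSymI)
    fix m assume "coeff (f + g) m \<noteq> 0"
    then have "coeff f m \<noteq> 0 \<or> coeff g m \<noteq> 0" by auto
    then show "deg m \<le> max d e" using d[of m] e[of m] by auto
  next
    fix \<alpha> "is" js
    assume "\<alpha> \<in> Comp" "is \<in> incr_seqs (length \<alpha>)" "js \<in> incr_seqs (length \<alpha>)"
    then show "coeff (f + g) (mono_of is \<alpha>) = coeff (f + g) (mono_of js \<alpha>)"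
      using QSym_coeff_eq[OF assms(1)] QSym_coeff_eq[OF assms(2)] by (metis coeff_plus)
  qed
qed

lemma sum_in_QSym: "(\<And>x. x \<in> A \<Longrightarrow> f x \<in> QSym) \<Longrightarrow> sum f A \<in> QSym"
  by (induction A rule: infinite_finite_induct) (auto simp: zero_in_QSym plus_in_QSym)

abbreviation coord :: "'k::{comm_ring,monoid_mult} mpseries \<Rightarrow> nat list \<Rightarrow> 'k" where
  "coord f \<alpha> \<equiv> coeff f (mono_of [0..<length \<alpha>] \<alpha>)"

lemma upt_incr_seqs [simp]: "[0..<n] \<in> incr_seqs n"
  by (simp add: incr_seqs_def)

lemma coord_bounded:
  assumes "f \<in> QSym"
  obtains d where "\<And>\<alpha>. \<alpha> \<in> Comp \<Longrightarrow> coord f \<alpha> \<noteq> 0 \<Longrightarrow> sum_list \<alpha> \<le> d"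
proof -
  obtain d where "\<And>m. coeff f m \<noteq> 0 \<Longrightarrow> deg m \<le> d" using assms unfolding QSym_def by blast
  then have "\<And>\<alpha>. \<alpha> \<in> Comp \<Longrightarrow> coord f \<alpha> \<noteq> 0 \<Longrightarrow> sum_list \<alpha> \<le> d"
    by (metis deg_mono_of upt_incr_seqs)
  then show ?thesis by (rule that)
qed

definition supp :: "'k::{comm_ring,monoid_mult} mpseries \<Rightarrow> nat list set" where
  "supp f = {\<alpha> \<in> Comp. coord f \<alpha> \<noteq> 0}"

lemma finite_supp: "f \<in> QSym \<Longrightarrow> finite (supp f)"
  by (erule coord_bounded, rule finite_subset[OF _ finite_Comp_le]) (auto simp: supp_def)

text \<open>The \<open>M\<^sub>\<alpha>\<close> span \<open>QSym\<close>; by \<open>coeff_M\<close> they are linearly independent.\<close>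

lemma QSym_expansion:
  assumes "f \<in> QSym" shows "f = (\<Sum>\<alpha>\<in>supp f. coord f \<alpha> *\<^sub>k M \<alpha>)"
proof (rule mpseries_eqI)
  fix m
  obtain \<beta> "is" where b: "\<beta> \<in> Comp" "is \<in> incr_seqs (length \<beta>)" "m = mono_of is \<beta>"
    using mono_of_exists by metis
  have c: "coeff f m = coord f \<beta>" using assms b upt_incr_seqs unfolding QSym_def by blast
  have "coeff (\<Sum>\<alpha>\<in>supp f. coord f \<alpha> *\<^sub>k M \<alpha>) m = (\<Sum>\<alpha>\<in>supp f. if \<alpha> = \<beta> then coord f \<alpha> else 0)"
    unfolding coeff_sum by (intro sum.cong) (use b in \<open>auto simp: coeff_M supp_def\<close>)
  also have "\<dots> = coord f \<beta>"
    using finite_supp[OF assms] b by (auto simp: sum.delta supp_def)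
  finally show "coeff f m = coeff (\<Sum>\<alpha>\<in>supp f. coord f \<alpha> *\<^sub>k M \<alpha>) m" using c by simp
qed

lemma linear_QSym_sum:
  assumes R: "linear_QSym R" and fin: "finite A" and A: "\<And>x. x \<in> A \<Longrightarrow> f x \<in> QSym"
  shows "R (sum f A) = (\<Sum>x\<in>A. R (f x))"
  using fin A
proof (induction A)
  case empty
  have "R (0 + 0) = R 0 + R 0" using R zero_in_QSym unfolding linear_QSym_def by blast
  then show ?case by simp
next
  case (insert x A)
  then have "R (f x + sum f A) = R (f x) + R (sum f A)"
    using R sum_in_QSym[of A f] unfolding linear_QSym_def by simp
  then show ?case using insert by simp
qed

text \<open>Existence of \<open>R\<^sub>q\<close>, and its uniqueness on \<open>QSym\<close>.\<close>

lemma is_R_exists: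
  fixes q :: "'k::{comm_ring,monoid_mult}"
  shows "\<exists>R. is_R q R"
proof -
  define g :: "nat list \<Rightarrow> 'k mpseries"
    where "g \<alpha> = (q + 1) ^ length (compl \<alpha>) *\<^sub>k M (compl \<alpha>)" for \<alpha>
  define R where "R f = (\<Sum>\<alpha>\<in>supp f. coord f \<alpha> *\<^sub>k g \<alpha>)" for f
  have g: "g \<alpha> \<in> QSym" for \<alpha>
    using compl_props(1)[of \<alpha>] by (simp add: g_def Comp_n_def M_in_QSym scale_in_QSym)
  have R_eq: "R f = (\<Sum>\<alpha>\<in>A. coord f \<alpha> *\<^sub>k g \<alpha>)" if "finite A" "supp f \<subseteq> A" "A \<subseteq> Comp" for f A
    unfolding R_def using that
    by (intro sum.mono_neutral_left) (auto simp: supp_def intro!: mpseries_eqI)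
  have 1: "R f \<in> QSym" for f
    unfolding R_def by (intro sum_in_QSym scale_in_QSym g)
  have 2: "R (f + h) = R f + R h" if "f \<in> QSym" "h \<in> QSym" for f h
  proof -
    have fin: "finite (supp f \<union> supp h)" and sub: "supp f \<union> supp h \<subseteq> Comp"
      using that finite_supp by (auto simp: supp_def)
    have s: "supp (f + h) \<subseteq> supp f \<union> supp h" by (auto simp: supp_def)
    have "R f = (\<Sum>\<alpha>\<in>supp f \<union> supp h. coord f \<alpha> *\<^sub>k g \<alpha>)"
      "R h = (\<Sum>\<alpha>\<in>supp f \<union> supp h. coord h \<alpha> *\<^sub>k g \<alpha>)"
      "R (f + h) = (\<Sum>\<alpha>\<in>supp f \<union> supp h. coord (f + h) \<alpha> *\<^sub>k g \<alpha>)"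
      by (rule R_eq; use fin sub s in blast)+
    then show ?thesis
      by (auto simp: distrib_right sum.distrib intro!: mpseries_eqI)
  qed
  have 3: "R (c *\<^sub>k f) = c *\<^sub>k R f" if "f \<in> QSym" for c f
  proof -
    have "R (c *\<^sub>k f) = (\<Sum>\<alpha>\<in>supp f. coord (c *\<^sub>k f) \<alpha> *\<^sub>k g \<alpha>)"
      using finite_supp[OF that] by (intro R_eq) (auto simp: supp_def)
    then show ?thesis
      unfolding R_def by (auto simp: sum_distrib_left mult.assoc intro!: mpseries_eqI)
  qed
  have 4: "R (M \<alpha>) = g \<alpha>" if "\<alpha> \<in> Comp" for \<alpha>
  proof -
    have "R (M \<alpha>) = (\<Sum>\<beta>\<in>{\<alpha>}. coord (M \<alpha>) \<beta> *\<^sub>k g \<beta>)"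
      using that by (intro R_eq) (auto simp: supp_def coeff_M split: if_splits)
    then show ?thesis using that by (auto simp: coeff_M intro!: mpseries_eqI)
  qed
  have "is_R q R"
    unfolding is_R_def linear_QSym_def using 1 2 3 4 by (simp add: g_def)
  then show ?thesis by blast
qed

lemma is_R_unique:
  assumes "is_R q R" "is_R q R'" "f \<in> QSym"
  shows "R f = R' f"
proof -
  have f: "f = (\<Sum>\<alpha>\<in>supp f. coord f \<alpha> *\<^sub>k M \<alpha>)" using assms by (intro QSym_expansion)
  have *: "S f = (\<Sum>\<alpha>\<in>supp f. coord f \<alpha> *\<^sub>k (q + 1) ^ length (compl \<alpha>) *\<^sub>k M (compl \<alpha>))"
    if "is_R q S" for S
  proof -
    have lin: "linear_QSym S" using that by (simp add: is_R_def)
    have "S f = (\<Sum>\<alpha>\<in>supp f. S (coord f \<alpha> *\<^sub>k M \<alpha>))"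
      by (subst f, rule linear_QSym_sum[OF lin finite_supp[OF assms(3)]])
        (auto simp: supp_def intro!: scale_in_QSym M_in_QSym)
    also have "\<dots> = (\<Sum>\<alpha>\<in>supp f. coord f \<alpha> *\<^sub>k (q + 1) ^ length (compl \<alpha>) *\<^sub>k M (compl \<alpha>))"
    proof (rule sum.cong)
      fix \<alpha> assume "\<alpha> \<in> supp f"
      then have "\<alpha> \<in> Comp" by (simp add: supp_def)
      then have "S (coord f \<alpha> *\<^sub>k M \<alpha>) = coord f \<alpha> *\<^sub>k S (M \<alpha>)"
        using lin M_in_QSym unfolding linear_QSym_def by blast
      then show "S (coord f \<alpha> *\<^sub>k M \<alpha>) =
          coord f \<alpha> *\<^sub>k (q + 1) ^ length (compl \<alpha>) *\<^sub>k M (compl \<alpha>)"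
        using that \<open>\<alpha> \<in> Comp\<close> by (simp add: is_R_def)
    qed simp
    finally show ?thesis .
  qed
  show ?thesis using *[OF assms(1)] *[OF assms(2)] by simp
qed

end

theory Submission
  imports Defs
begin

text \<open>
  Complementation reverses the refinement order: passing from \<open>\<beta>\<close> to its complement replaces
  \<open>D \<beta>\<close> by the complementary set, so \<open>D \<beta>\<close> contains the complement of \<open>D \<alpha>\<close> exactly when the
  descent set of the complement of \<open>\<beta>\<close> lies in \<open>D \<alpha>\<close> (\<open>D_compl_subset_iff\<close>).  Being an involution
  on the compositions of a given size (\<open>compl_compl\<close>), it therefore matches the compositions that
  index \<open>L\<close> of the complement of \<open>\<alpha>\<close> with those that index \<open>eta q \<alpha>\<close>.  The map \<open>R\<^sub>q\<close> carries out
  this matching on the basis \<open>M\<close>, and supplies the power of \<open>r = q + 1\<close> attached to each term of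
  \<open>eta q \<alpha>\<close>; linearity does the rest.
\<close>

lemma sum_list_compl [simp]: "sum_list (compl \<alpha>) = sum_list \<alpha>"
  using compl_props(1) by (simp add: Comp_n_def)

lemma compl_in_Comp [simp]: "compl \<alpha> \<in> Comp"
  using compl_props(1) by (simp add: Comp_n_def)

text \<open>
  Both sides have the same size and the same descent set, and these two data determine a
  composition.
\<close>

lemma compl_compl:
  assumes "\<alpha> \<in> Comp"
  shows "compl (compl \<alpha>) = \<alpha>"
proof (rule D_inj)
  show "D (compl (compl \<alpha>)) = D \<alpha>"
    using D_subset[OF assms] by (auto simp: compl_props(2))
qed (use assms in simp_all)

lemma D_compl_subset_iff:
  assumes "\<alpha> \<in> Comp" "\<beta> \<in> Comp" "sum_list \<alpha> = sum_list \<beta>"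
  shows "D (compl \<beta>) \<subseteq> D \<alpha> \<longleftrightarrow> D (compl \<alpha>) \<subseteq> D \<beta>"
  using D_subset[OF assms(1)] D_subset[OF assms(2)] assms(3) by (auto simp: compl_props(2))

theorem theorem7p5:
  fixes q :: "'k::{comm_ring,monoid_mult}"
    and R\<^sub>q :: "'k mpseries \<Rightarrow> 'k mpseries"
    and \<alpha> :: "nat list"
  assumes "is_R q R\<^sub>q"
    and "\<alpha> \<in> Comp"
  shows "eta q \<alpha> = R\<^sub>q (L (compl \<alpha>))"
proof -
  let ?n = "sum_list \<alpha>"
  let ?A = "{\<beta> \<in> Comp_n ?n. D (compl \<alpha>) \<subseteq> D \<beta>}"
  let ?B = "{\<beta> \<in> Comp_n ?n. D \<beta> \<subseteq> D \<alpha>}"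
  have lin: "linear_QSym R\<^sub>q"
    using assms(1) by (simp add: is_R_def)
  have "R\<^sub>q (L (compl \<alpha>)) = (\<Sum>\<beta>\<in>?A. R\<^sub>q (M \<beta>))"
    unfolding L_def sum_list_compl
    by (rule linear_QSym_sum[OF lin]) (simp add: finite_Comp_n, simp add: Comp_n_def M_in_QSym)
  also have "\<dots> = (\<Sum>\<beta>\<in>?A. (q + 1) ^ length (compl \<beta>) *\<^sub>k M (compl \<beta>))"
    using assms(1) by (intro sum.cong) (auto simp: is_R_def Comp_n_def)
  also have "\<dots> = (\<Sum>\<gamma>\<in>?B. (q + 1) ^ length \<gamma> *\<^sub>k M \<gamma>)"
  proof (rule sum.reindex_bij_witness[where i = compl and j = compl])
    fix \<beta> assume "\<beta> \<in> ?A"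
    then show "compl \<beta> \<in> ?B" "compl (compl \<beta>) = \<beta>"
      using assms(2) by (auto simp: Comp_n_def compl_compl D_compl_subset_iff)
  next
    fix \<gamma> assume \<gamma>: "\<gamma> \<in> ?B"
    then show "compl (compl \<gamma>) = \<gamma>"
      by (simp add: Comp_n_def compl_compl)
    then show "compl \<gamma> \<in> ?A"
      using \<gamma> assms(2) D_compl_subset_iff[of \<alpha> "compl \<gamma>"] by (simp add: Comp_n_def)
  qed simp
  also have "\<dots> = eta q \<alpha>"
    by (simp add: eta_def Let_def)
  finally show ?thesis ..
qed

end
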